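(* Let $n$ be a positive integer, let $\ell>0$ be a real number, and let $M^<$ be an ordered matching on the vertex set $[2n]$ with $\chi_<(M^<)=2$ and $L(\pi_{M^<})\leq \ell$. If $N\geq 4n(\sqrt{n\ell}+1)$, then every red-blue coloring $\chi$ of the edges of $K_{2N}^<$ on $[2N]$ satisfies at least one of the following: (a) $\chi$ contains a blue copy of $K_3^<$; (b) $\chi$ contains a red copy of $K_{2n}^<$; (c) $\chi$ contains a red copy of $M^<$ between $[N]$ and $\{N+1,\dots,2N\}$, i.e., there is an order-preserving injection $\phi:[2n]\to[2N]$ with $\phi([n])\subseteq [N]$ and $\phi(\{n+1,\dots,2n\})\subseteq\{N+1,\dots,2N\}$ such that $\{\phi(u),\phi(v)\}$ is red for every edge $\{u,v\}$ of $M^<$.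
   Context: An ordered graph is a graph with a linear ordering of its vertices; an ordered matching is a $1$-regular ordered graph. $K_m^<$ is the complete graph on $[m]=\{1,\dots,m\}$ with the natural order; a red (blue) copy of an ordered graph $G^<$ in a coloring is an order-preserving injective map of its vertices sending every edge to a red (blue) edge. The interval chromatic number $\chi_<(G^<)$ is the minimum number of intervals of consecutive vertices partitioning the vertex set so that no edge lies inside an interval. For an ordered matching $M^<$ on $[2n]$ with $\chi_<(M^<)=2$ (so every edge $\{i,j\}$ has $i\le n<j$), $\pi_{M^<}$ is the permutation of $[n]$ mapping $i$ to $j-n$ for every edge $\{i,j\}$ of $M^<$ with $i<j$. For a permutation $\pi$ of $[n]$, a set $C=\{c_1<\dots<c_k\}\subseteq[n]$ is a shift of a set $D=\{d_1<\dots<d_k\}\subseteq[n]$ in $\pi$ if there is a positive integer $\Delta$ with $\pi(c_i)=\pi(d_i)+\Delta$ for all $i\in[k]$. $L(\pi)$ is the largest positive integer $k$ for which there are sets $C,D\subseteq[n]$ of size $k$ such that $C$ is a shift of $D$ in $\pi$. *)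

theory Defs
  imports Complex_Main "HOL-Library.Disjoint_Sets"
begin

record 'a ograph =
  verts :: "'a set"
  edges :: "'a set set"

definition ordered_graph :: "'a::linorder ograph \<Rightarrow> bool" where
  "ordered_graph G \<longleftrightarrow> finite (verts G) \<and> (\<forall>e\<in>edges G. e \<subseteq> verts G \<and> card e = 2)"

definition ordered_matching :: "'a::linorder ograph \<Rightarrow> bool" where
  "ordered_matching G \<longleftrightarrow>
     ordered_graph G \<and> (\<forall>v\<in>verts G. card {e \<in> edges G. v \<in> e} = 1)"

definition complete_ograph :: "nat \<Rightarrow> nat ograph" where
  "complete_ograph m = \<lparr>verts = {1..m}, edges = {e. e \<subseteq> {1..m} \<and> card e = 2}\<rparr>"

definition vertex_interval :: "'a::linorder ograph \<Rightarrow> 'a set \<Rightarrow> bool" where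
  "vertex_interval G I \<longleftrightarrow>
     I \<subseteq> verts G \<and> (\<forall>x\<in>I. \<forall>z\<in>I. \<forall>y\<in>verts G. x \<le> y \<and> y \<le> z \<longrightarrow> y \<in> I)"

definition interval_chromatic_number :: "'a::linorder ograph \<Rightarrow> nat" where
  "interval_chromatic_number G =
     (LEAST k. \<exists>P. partition_on (verts G) P \<and> finite P \<and> card P = k \<and>
        (\<forall>I\<in>P. vertex_interval G I \<and> (\<forall>e\<in>edges G. \<not> e \<subseteq> I)))"

datatype color = Red | Blue

(* An edge coloring is a total function on sets; only its values on edges of the
   host graph H are ever inspected. *)
definition mono_copy ::
  "('b::linorder set \<Rightarrow> color) \<Rightarrow> color \<Rightarrow> 'b ograph \<Rightarrow> 'a::linorder ograph \<Rightarrow> ('a \<Rightarrow> 'b) \<Rightarrow> bool" where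
  "mono_copy \<chi> c H G \<phi> \<longleftrightarrow>
     strict_mono_on (verts G) \<phi> \<and> \<phi> ` verts G \<subseteq> verts H \<and>
     (\<forall>e\<in>edges G. \<phi> ` e \<in> edges H \<and> \<chi> (\<phi> ` e) = c)"

(* Intended for an ordered matching on {1..2n} with interval chromatic number 2;
   extended by the identity outside {1..n}. *)
definition matching_perm :: "nat \<Rightarrow> nat ograph \<Rightarrow> nat \<Rightarrow> nat" where
  "matching_perm n M i =
     (if i \<in> {1..n} then (THE j. i < j \<and> {i, j} \<in> edges M) - n else i)"

(* The increasing enumeration of a finite set C is sorted_list_of_set C. *)
definition is_shift :: "(nat \<Rightarrow> nat) \<Rightarrow> nat set \<Rightarrow> nat set \<Rightarrow> bool" where
  "is_shift \<pi> C D \<longleftrightarrow> card C = card D \<and>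
     (\<exists>\<Delta>>0. \<forall>i<card C. \<pi> (sorted_list_of_set C ! i) = \<pi> (sorted_list_of_set D ! i) + \<Delta>)"

(* The set below is finite, and nonempty for a permutation of {1..n} with n \<ge> 2, so the
   supremum is then its maximum. For n = 1 it is empty, and the supremum in nat is 0. *)
definition max_shift :: "nat \<Rightarrow> (nat \<Rightarrow> nat) \<Rightarrow> nat" where
  "max_shift n \<pi> = Sup {k. k > 0 \<and> (\<exists>C D. C \<subseteq> {1..n} \<and> D \<subseteq> {1..n} \<and>
     card C = k \<and> card D = k \<and> is_shift \<pi> C D)}"

end

theory Submission
  imports Defs "HOL-Analysis.Convex"
begin

text \<open>
  Without a blue triangle, the blue neighbourhood of a vertex is a red clique, so without a red
  clique on \<open>2n\<close> vertices every blue degree is less than \<open>2n\<close>. It remains to find a permutation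
  \<open>\<pi>\<close> with few shifts among the red entries of an \<open>N \<times> N\<close> matrix whose rows and columns each
  contain at most \<open>2n\<close> blue entries.

  Cut the columns into \<open>2n\<close> blocks of width \<open>w = N div 2n\<close>. For each offset \<open>D = 0, \<dots>, n\<close> scan the
  rows greedily, placing the \<open>i\<close>-th entry of the pattern in the first available row that has a red
  entry in column block \<open>\<pi> i + D\<close>. If this fails for all \<open>D\<close>, each \<open>D\<close> yields a set \<open>S D\<close> of at
  least \<open>N + 1 - n\<close> pairs of a row and a column block that is entirely blue in that row; altogether
  there are at most \<open>2nN / w\<close> such pairs. A common element of \<open>S D\<close> and \<open>S E\<close> with \<open>D < E\<close> comes from
  indices \<open>c, d\<close> with \<open>\<pi> c = \<pi> d + (E - D)\<close>, and both indices are monotone in the row, so these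
  index pairs form a shift; hence \<open>S D\<close> and \<open>S E\<close> share at most \<open>2nL\<close> pairs. By Cauchy-Schwarz this is
  incompatible with the lower bound on \<open>N\<close>.
\<close>

subsection \<open>Greedy embedding\<close>

text \<open>The value at \<open>x\<close> is the pattern index, counted from 1, that is tried at row \<open>x\<close>.\<close>

primrec greedy :: "(nat \<Rightarrow> nat \<Rightarrow> bool) \<Rightarrow> nat \<Rightarrow> nat" where
  "greedy P 0 = 1"
| "greedy P (Suc x) = (if P (greedy P x) x then Suc (greedy P x) else greedy P x)"

lemma greedy_mono: "x \<le> y \<Longrightarrow> greedy P x \<le> greedy P y"
  by (rule lift_Suc_mono_le) auto

lemma greedy_pos: "1 \<le> greedy P x"
  using greedy_mono[of 0 x P] by simp

text \<open>Every row either advances the index by one or counts as a failure. As the index starts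
  at 1, a final value of at most \<open>n\<close> leaves at least \<open>N + 1 - n\<close>
  failures.\<close>

lemma card_greedy_failures:
  "card {x. x < N \<and> \<not> P (greedy P x) x} + greedy P N = Suc N"
proof (induction N)
  case (Suc N)
  have "{x. x < Suc N \<and> \<not> P (greedy P x) x} =
      (if P (greedy P N) N then {} else {N}) \<union> {x. x < N \<and> \<not> P (greedy P x) x}"
    by (auto simp: less_Suc_eq)
  then show ?case
    using Suc by auto
qed simp

text \<open>The index grows by at most one per row, so it cannot skip \<open>i\<close>; the row
  where it leaves \<open>i\<close> satisfies \<open>P i\<close>.\<close>

lemma greedy_step:
  "1 \<le> i \<Longrightarrow> i < greedy P N \<Longrightarrow> \<exists>x<N. greedy P x = i \<and> P i x"
proof (induction N)
  case (Suc N)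
  then show ?case
    by (cases "i < greedy P N") (auto simp: less_Suc_eq split: if_splits)
qed simp

text \<open>At row \<open>r i\<close> the index equals \<open>i\<close>, so monotonicity of
  \<open>greedy P\<close> forces these rows to increase with \<open>i\<close>.\<close>

lemma greedy_success:
  assumes "n < greedy P N"
  obtains r where "strict_mono_on {1..n} r" "\<And>i. i \<in> {1..n} \<Longrightarrow> r i < N"
    "\<And>i. i \<in> {1..n} \<Longrightarrow> P i (r i)"
proof -
  have "\<forall>i\<in>{1..n}. \<exists>x<N. greedy P x = i \<and> P i x"
    using assms by (auto intro!: greedy_step)
  then obtain r where r: "\<And>i. i \<in> {1..n} \<Longrightarrow> r i < N \<and> greedy P (r i) = i \<and> P i (r i)"
    by metis
  have "strict_mono_on {1..n} r"
  proof (rule strict_mono_onI, rule ccontr)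
    fix i j assume "i \<in> {1..n}" "j \<in> {1..n}" "i < j" "\<not> r i < r j"
    then show False
      using greedy_mono[of "r j" "r i" P] r by auto
  qed
  then show ?thesis
    using that r by blast
qed

subsection \<open>Counting\<close>

text \<open>Let \<open>m u\<close> be the number of sets containing \<open>u\<close>. Its sum over
  \<open>U\<close> is \<open>T\<close>; the sum of its squares adds up the overlaps over all ordered
  pairs of indices, where the diagonal gives \<open>T\<close> and every other pair at most
  \<open>c\<close>. Cauchy-Schwarz compares the two sums.\<close>

lemma second_moment:
  fixes c :: real and S :: "'a \<Rightarrow> 'b set"
  assumes "finite I" "finite U" "\<And>i. i \<in> I \<Longrightarrow> S i \<subseteq> U"
    and ov: "\<And>i j. i \<in> I \<Longrightarrow> j \<in> I \<Longrightarrow> i \<noteq> j \<Longrightarrow> real (card (S i \<inter> S j)) \<le> c"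
  defines "T \<equiv> \<Sum>i\<in>I. real (card (S i))"
  shows "T\<^sup>2 \<le> (T + real (card I) * (real (card I) - 1) * c) * real (card U)"
proof -
  define m where "m u = (\<Sum>i\<in>I. of_bool (u \<in> S i) :: real)" for u
  have ind: "\<And>A. A \<subseteq> U \<Longrightarrow> (\<Sum>u\<in>U. of_bool (u \<in> A)) = real (card A)"
    using \<open>finite U\<close> by (simp add: Int_absorb1)
  have "(\<Sum>u\<in>U. m u) = T"
    unfolding m_def T_def by (subst sum.swap) (simp add: ind assms(3))
  moreover have "(\<Sum>u\<in>U. (m u)\<^sup>2) \<le> T + real (card I) * (real (card I) - 1) * c"
  proof -
    have "(\<Sum>u\<in>U. (m u)\<^sup>2) = (\<Sum>u\<in>U. \<Sum>i\<in>I. \<Sum>j\<in>I. of_bool (u \<in> S i \<inter> S j))"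
      by (simp add: m_def power2_eq_square sum_product of_bool_conj)
    also have "\<dots> = (\<Sum>i\<in>I. \<Sum>j\<in>I. \<Sum>u\<in>U. of_bool (u \<in> S i \<inter> S j))"
      by (subst sum.swap) (auto intro!: sum.cong sum.swap)
    also have "\<dots> = (\<Sum>i\<in>I. \<Sum>j\<in>I. real (card (S i \<inter> S j)))"
      using assms(3) by (intro sum.cong refl ind) auto
    also have "\<dots> \<le> (\<Sum>i\<in>I. real (card (S i)) + (real (card I) - 1) * c)"
    proof (rule sum_mono)
      fix i assume i: "i \<in> I"
      have "(\<Sum>j\<in>I - {i}. real (card (S i \<inter> S j))) \<le> real (card (I - {i})) * c"
        using ov i by (intro sum_bounded_above) auto
      moreover have "real (card (I - {i})) = real (card I) - 1"
        using card_Suc_Diff1[OF \<open>finite I\<close> i] by simp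
      ultimately show "(\<Sum>j\<in>I. real (card (S i \<inter> S j))) \<le> real (card (S i)) + (real (card I) - 1) * c"
        using i \<open>finite I\<close> by (simp add: sum.remove[of I i])
    qed
    finally show ?thesis
      by (simp add: T_def sum.distrib)
  qed
  ultimately show ?thesis
    using sum_squared_le_sum_of_squares[of m U]
    by (meson mult_right_mono of_nat_0_le_iff order_trans)
qed

text \<open>Multiplying \<open>sq\<close> by \<open>w\<close> eliminates \<open>A\<close> through
  the bound on \<open>A * w\<close>. Then \<open>T\<close> is replaced by its lower bound
  \<open>a * v\<close> with \<open>a = n (n + 1)\<close>, and dividing by the square of
  \<open>a\<close> leaves the inequality \<open>key\<close>.\<close>

lemma counting_contradiction:
  fixes n N w A :: nat and L T :: real
  assumes n: "n > 0" and L: "n \<ge> 2 \<Longrightarrow> L \<ge> 1" and L0: "L \<ge> 0"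
    and N: "real N \<ge> 4 * real n * (sqrt (real n * L) + 1)"
    and w: "w = N div (2 * n)"
    and A: "A * w \<le> 2 * n * N"
    and T: "T \<ge> real (n + 1) * (real N + 1 - real n)"
    and sq: "T\<^sup>2 \<le> (T + real (n + 1) * real n * (2 * real n * L)) * real A"
  shows False
proof -
  define s where "s = sqrt (real n * L)"
  have s0: "s \<ge> 0" and ss: "s\<^sup>2 = real n * L"
    using L0 by (auto simp: s_def)
  \<comment> \<open>After dividing by the powers of \<open>n\<close>, only \<open>s = sqrt (n L)\<close> and \<open>v = N / n - 1 \<ge> 4 s + 3\<close> matter.
      The case \<open>s < 1\<close> can only occur for \<open>n = 1\<close>, where \<open>L\<close> may be 0.\<close>
  define v where "v = real N / real n - 1"
  have Nv: "real N = real n * (v + 1)"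
    using n by (simp add: v_def)
  have v: "v \<ge> 4 * s + 3"
  proof -
    have "real n * (4 * s + 4) \<le> real n * (v + 1)"
      using N unfolding s_def[symmetric] Nv by (simp add: algebra_simps)
    then show ?thesis using n by simp
  qed
  \<comment> \<open>Rounding down costs less than one: \<open>w + 1\<close> exceeds
    \<open>N / (2 n) = (v + 1) / 2\<close>.\<close>
  have "N < 2 * n * Suc w"
    unfolding w using n by (metis dividend_less_times_div mult_Suc_right nat_0_less_mult_iff zero_less_numeral add.commute)
  then have "real n * (v + 1) < 2 * real n * (real w + 1)"
    unfolding Nv[symmetric] by (metis of_nat_less_iff of_nat_mult of_nat_numeral of_nat_Suc add.commute)
  then have "real w > (v - 1) / 2"
  proof -
    assume "real n * (v + 1) < 2 * real n * (real w + 1)"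
    then have "real n * (v + 1) < real n * (2 * (real w + 1))" by (simp add: algebra_simps)
    then have "v + 1 < 2 * (real w + 1)" using n by (simp only: mult_less_cancel_left_pos of_nat_0_less_iff)
    then show ?thesis by simp
  qed
  then have w1: "real w > 2 * s + 1" using v by simp
  define X where "X = real (n + 1) * real n * (2 * real n * L)"
  have X: "X = real (n + 1) * real n * (2 * s\<^sup>2)" by (simp add: X_def ss)
  have X0: "X \<ge> 0" by (simp add: X)
  have Tv: "T \<ge> real (n + 1) * (real n * v)"
  proof -
    have "real (n + 1) * (real n * v) \<le> real (n + 1) * (real N + 1 - real n)"
      by (intro mult_left_mono) (auto simp: Nv algebra_simps)
    then show ?thesis using T by linarith
  qed
  have Tpos: "T > 0"
    using Tv v s0 n by (smt (verit) mult_pos_pos of_nat_0_less_iff add_gr_0)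
  have Aw: "real A * real w \<le> 2 * real n * real N"
    using A by (metis of_nat_le_iff of_nat_mult of_nat_numeral)
  have "T\<^sup>2 * real w \<le> (T + X) * (real A * real w)"
    using mult_right_mono[OF sq, of "real w"] by (simp add: X_def mult.assoc)
  also have "\<dots> \<le> (T + X) * (2 * real n * real N)"
    using Aw Tpos X0 by (intro mult_left_mono) auto
  finally have 1: "T * (T * real w - 2 * real n * real N) \<le> X * (2 * real n * real N)"
    by (simp add: algebra_simps power2_eq_square)
  define a where "a = real (n + 1) * real n"
  have a: "a > 0" using n by (simp add: a_def)
  \<comment> \<open>This factor is left over when \<open>2 n N = 2 n^2 (v + 1)\<close> is divided by
    \<open>a = n (n + 1)\<close>. For \<open>s >= 1\<close> the bound \<open>q <= 1\<close>
    suffices; for \<open>n = 1\<close> the exact value 1/2 is used.\<close>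
  define q where "q = real n / (real n + 1)"
  have q: "q \<le> 1" "q \<ge> 0" by (simp_all add: q_def)
  have e: "2 * real n * real N = a * (2 * (v + 1) * q)"
    by (simp add: Nv a_def q_def field_simps)
  have key: "v * (v * real w - 2 * (v + 1) * q) > 2 * s\<^sup>2 * (2 * (v + 1) * q)"
  proof (cases "s \<ge> 1")
    case True
    have "2 * s\<^sup>2 * (2 * (v + 1) * q) + v * (2 * (v + 1) * q) \<le> (2 * s\<^sup>2 + v) * (2 * (v + 1))"
      using q v s0 by (simp add: distrib_right[symmetric] mult.assoc[symmetric] mult_left_le)
    also have "\<dots> < v * (v * (2 * s + 1))"
    proof -
      have "(4 * s + 3) * (2 * s - 1) \<le> v * (2 * s - 1)"
        using v True by (intro mult_right_mono) auto
      then have "8 * s\<^sup>2 + 2 * s - 3 \<le> v * (2 * s - 1)"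
        by (simp add: algebra_simps power2_eq_square)
      then have "v * (8 * s\<^sup>2 + 2 * s - 3) \<le> v * (v * (2 * s - 1))"
        using v s0 by (intro mult_left_mono) auto
      moreover have s2: "s\<^sup>2 \<ge> 1" using True by (simp add: one_le_power)
      \<comment> \<open>Here \<open>v >= 4 s + 3 >= 7\<close> and \<open>2 s >= 2\<close>. What must
        then be positive is \<open>7 (4 s^2 - 3) - 4 s^2 = 24 s^2 - 21\<close>.\<close>
      moreover have "7 * (4 * s\<^sup>2 - 3) \<le> v * (4 * s\<^sup>2 + 2 * s - 5)"
        using v True s2 by (intro mult_mono) linarith+
      ultimately show ?thesis
        by (simp add: algebra_simps)
    qed
    also have "\<dots> \<le> v * (v * real w)"
      using v s0 w1 by (intro mult_left_mono) auto
    finally show ?thesis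
      by (simp add: algebra_simps)
  next
    case False
    have "n = 1"
    proof (rule ccontr)
      assume "n \<noteq> 1"
      then have n2: "n \<ge> 2" using n by simp
      then have "1 * 1 \<le> real n * L"
        using L[OF n2] by (intro mult_mono) auto
      then show False
        using False by (simp add: s_def)
    qed
    then have q: "q = 1 / 2" by (simp add: q_def)
    \<comment> \<open>Integrality matters here: rounding \<open>w > 1\<close> up to 2 makes
      \<open>v * w - (v + 1)\<close> at least \<open>v - 1\<close>.\<close>
    have w2: "real w \<ge> 2"
    proof -
      have "1 < real w" using w1 s0 by linarith
      then show ?thesis by simp
    qed
    have "2 * s\<^sup>2 * (2 * (v + 1) * q) = 2 * s\<^sup>2 * (v + 1)" by (simp add: q)
    also have "\<dots> \<le> (2 * s) * (v + 1)"
      using False s0 v by (intro mult_right_mono) (auto simp: power2_eq_square mult_left_le)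
    also have "\<dots> \<le> (v - 3) / 2 * (v + 1)"
      using v s0 by (intro mult_right_mono) auto
    also have "\<dots> < v * (v - 1)"
    proof -
      have "0 < v * v" using v s0 by simp
      then show ?thesis by (simp add: field_simps)
    qed
    also have "\<dots> = v * (v * 2 - 2 * (v + 1) * q)"
      by (simp add: q algebra_simps)
    also have "\<dots> \<le> v * (v * real w - 2 * (v + 1) * q)"
      using v s0 w2 by (intro mult_left_mono diff_right_mono) auto
    finally show ?thesis .
  qed
  \<comment> \<open>With both factors nonnegative at \<open>a * v\<close>, the product
    \<open>T (T w - 2 n N)\<close> is at least its value with \<open>a * v\<close> in place of
    \<open>T\<close>.\<close>
  have pos: "v * real w - 2 * (v + 1) * q > 0"
  proof -
    have "0 \<le> 2 * s\<^sup>2 * (2 * (v + 1) * q)" using v s0 q by simp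
    then have "0 < v * (v * real w - 2 * (v + 1) * q)" using key by linarith
    then show ?thesis using v s0 by (simp add: zero_less_mult_iff)
  qed
  have Tav: "T \<ge> a * v" using Tv by (simp add: a_def)
  have "X * (2 * real n * real N) = a * a * (2 * s\<^sup>2 * (2 * (v + 1) * q))"
    unfolding e by (simp add: X a_def)
  also have "\<dots> < a * a * (v * (v * real w - 2 * (v + 1) * q))"
    using key a by (intro mult_strict_left_mono) auto
  also have "\<dots> = a * v * (a * v * real w - 2 * real n * real N)"
    unfolding e by (simp add: algebra_simps)
  also have "\<dots> \<le> T * (T * real w - 2 * real n * real N)"
  proof (intro mult_mono diff_right_mono mult_right_mono Tav)
    have "a * v * real w - 2 * real n * real N = a * (v * real w - 2 * (v + 1) * q)"
      unfolding e by (simp add: algebra_simps)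
    then show "0 \<le> a * v * real w - 2 * real n * real N"
      using a pos by simp
  qed (use Tpos in auto)
  finally show False using 1 by linarith
qed

subsection \<open>Permutations in sparse matrices\<close>

text \<open>For \<open>b >= 1\<close> this is the interval from \<open>(b - 1) * w + 1\<close> to
  \<open>b * w\<close>, written with \<open>y + w\<close> to avoid truncated subtraction. Columns
  and blocks are both counted from 1.\<close>

definition block :: "nat \<Rightarrow> nat \<Rightarrow> nat set" where
  "block w b = {y. y \<le> b * w \<and> b * w < y + w}"

lemma block_less:
  assumes "y \<in> block w b" "y' \<in> block w b'" "b < b'"
  shows "y < y'"
proof -
  have "b * w + w \<le> b' * w"
    using assms(3) by (metis Suc_leI add.commute mult_Suc mult_le_mono1)
  then show ?thesis
    using assms by (auto simp: block_def)
qed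

lemma card_block: "1 \<le> b \<Longrightarrow> card (block w b) = w"
proof -
  assume "1 \<le> b"
  then have "w \<le> b * w" by simp
  then have "block w b = {b * w - w<..b * w}"
    by (auto simp: block_def less_diff_conv2)
  then show ?thesis
    using \<open>w \<le> b * w\<close> by simp
qed

lemma block_subset: "1 \<le> b \<Longrightarrow> b * w \<le> N \<Longrightarrow> block w b \<subseteq> {1..N}"
proof
  fix y assume "1 \<le> b" "b * w \<le> N" "y \<in> block w b"
  moreover from \<open>1 \<le> b\<close> have "w \<le> b * w" by simp
  ultimately show "y \<in> {1..N}" unfolding block_def by (simp, linarith)
qed

lemma shift_overlap:
  fixes \<pi> :: "nat \<Rightarrow> nat" and p q :: "'a::linorder \<Rightarrow> nat"
  assumes "inj_on \<pi> {1..n}"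
    and shift: "\<And>C f \<Delta>. C \<subseteq> {1..n} \<Longrightarrow> f ` C \<subseteq> {1..n} \<Longrightarrow> strict_mono_on C f \<Longrightarrow> \<Delta> > 0 \<Longrightarrow>
      (\<And>c. c \<in> C \<Longrightarrow> \<pi> c = \<pi> (f c) + \<Delta>) \<Longrightarrow> card C \<le> L"
    and "mono p" "mono q" "p ` X \<subseteq> {1..n}" "q ` X \<subseteq> {1..n}" "D < (E :: nat)" "finite X"
    and eq: "\<And>x. x \<in> X \<Longrightarrow> \<pi> (p x) + D = \<pi> (q x) + E"
    and fib: "\<And>c. c \<in> p ` X \<Longrightarrow> card {x \<in> X. p x = c} \<le> k"
  shows "card X \<le> L * k"
proof -
  define g where "g = inv_into X p"
  have g: "g c \<in> X" "p (g c) = c" if "c \<in> p ` X" for c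
    using that by (simp_all add: g_def inv_into_into f_inv_into_f)
  have sh: "\<pi> c = \<pi> (q (g c)) + (E - D)" if "c \<in> p ` X" for c
    using eq[of "g c"] g[OF that] \<open>D < E\<close> by simp
  have "strict_mono_on (p ` X) (q \<circ> g)"
  proof (rule strict_mono_onI)
    fix c d assume cd: "c \<in> p ` X" "d \<in> p ` X" "c < d"
    then have "g c < g d"
      using g[OF cd(1)] g[OF cd(2)] monoD[OF \<open>mono p\<close>, of "g d" "g c"] by (metis leD leI)
    then have "q (g c) \<le> q (g d)"
      using monoD[OF \<open>mono q\<close>] by (simp add: less_imp_le)
    moreover have "\<pi> c \<noteq> \<pi> d"
      using \<open>inj_on \<pi> {1..n}\<close> cd \<open>p ` X \<subseteq> {1..n}\<close> by (metis inj_onD less_irrefl subsetD)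
    then have "q (g c) \<noteq> q (g d)"
      using sh[OF cd(1)] sh[OF cd(2)] by metis
    ultimately show "(q \<circ> g) c < (q \<circ> g) d" by simp
  qed
  moreover have "(q \<circ> g) ` p ` X \<subseteq> {1..n}"
    using g(1) \<open>q ` X \<subseteq> {1..n}\<close> by fastforce
  ultimately have L: "card (p ` X) \<le> L"
    using shift[of "p ` X" "q \<circ> g" "E - D"] sh \<open>D < E\<close> \<open>p ` X \<subseteq> {1..n}\<close> by simp
  have "X = (\<Union>c\<in>p ` X. {x \<in> X. p x = c})" by auto
  then have "card X \<le> (\<Sum>c\<in>p ` X. card {x \<in> X. p x = c})"
    using card_UN_le[of "p ` X" "\<lambda>c. {x \<in> X. p x = c}"] \<open>finite X\<close> by simp
  also have "\<dots> \<le> card (p ` X) * k"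
    using sum_bounded_above[of "p ` X" "\<lambda>c. card {x \<in> X. p x = c}" k] fib by simp
  also have "\<dots> \<le> L * k" using L by simp
  finally show ?thesis .
qed

text \<open>Within one row the full blocks are disjoint sets of \<open>w\<close> columns satisfying
  \<open>B\<close>, so \<open>w\<close> times their number is at most \<open>k\<close>. Summing over
  the rows gives the bound.\<close>

lemma card_full_blocks:
  assumes row: "\<And>x. x < N \<Longrightarrow> card {y \<in> {1..N}. B x y} \<le> k"
    and "K * w \<le> N"
  shows "card {(x, b). x < N \<and> b \<in> {1..K} \<and> (\<forall>y\<in>block w b. B x y)} * w \<le> k * N"
proof -
  define F where "F x = {b \<in> {1..K}. \<forall>y\<in>block w b. B x y}" for x
  have F: "card (F x) * w \<le> k" if "x < N" for x
  proof -
    have "card (F x) * w = (\<Sum>b\<in>F x. card (block w b))"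
      by (simp add: F_def card_block)
    also have "\<dots> = card (\<Union>b\<in>F x. block w b)"
    proof (rule card_UN_disjoint[symmetric])
      show "\<forall>i\<in>F x. finite (block w i)"
        unfolding block_def using finite_nat_set_iff_bounded_le by auto
      show "\<forall>i\<in>F x. \<forall>j\<in>F x. i \<noteq> j \<longrightarrow> block w i \<inter> block w j = {}"
        using block_less by (metis disjoint_iff less_irrefl linorder_neqE_nat)
    qed (simp add: F_def)
    also have "\<dots> \<le> card {y \<in> {1..N}. B x y}"
    proof (rule card_mono)
      have "block w b \<subseteq> {1..N}" if "b \<in> F x" for b
        using that \<open>K * w \<le> N\<close> by (intro block_subset) (auto simp: F_def intro: order_trans[OF mult_le_mono1])
      then show "(\<Union>b\<in>F x. block w b) \<subseteq> {y \<in> {1..N}. B x y}"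
        unfolding F_def by blast
    qed simp
    also have "\<dots> \<le> k" using row that by simp
    finally show ?thesis .
  qed
  have "{(x, b). x < N \<and> b \<in> {1..K} \<and> (\<forall>y\<in>block w b. B x y)} = Sigma {..<N} F"
    by (auto simp: F_def)
  moreover have "card (Sigma {..<N} F) * w = (\<Sum>x<N. card (F x) * w)"
    by (subst card_SigmaI) (auto simp: F_def sum_distrib_right)
  moreover have "\<dots> \<le> k * N"
    using sum_bounded_above[of "{..<N}" "\<lambda>x. card (F x) * w" k] F by (simp add: mult.commute)
  ultimately show ?thesis by simp
qed

text \<open>\<open>B\<close> stands for the blue entries, with rows counted from 0 and columns from
  1. The hypothesis \<open>shift\<close> expresses the bound on shifts by increasing maps, which are
  easier to produce than sorted enumerations.\<close>

lemma permutation_in_sparse_matrix: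
  fixes B :: "nat \<Rightarrow> nat \<Rightarrow> bool"
  assumes n: "n > 0"
    and pi: "inj_on \<pi> {1..n}" "\<pi> ` {1..n} \<subseteq> {1..n}"
    and shift: "\<And>C f \<Delta>. C \<subseteq> {1..n} \<Longrightarrow> f ` C \<subseteq> {1..n} \<Longrightarrow> strict_mono_on C f \<Longrightarrow> \<Delta> > 0 \<Longrightarrow>
      (\<And>c. c \<in> C \<Longrightarrow> \<pi> c = \<pi> (f c) + \<Delta>) \<Longrightarrow> card C \<le> L"
    and row: "\<And>x. x < N \<Longrightarrow> card {y \<in> {1..N}. B x y} \<le> 2 * n"
    and col: "\<And>y. y \<in> {1..N} \<Longrightarrow> card {x. x < N \<and> B x y} \<le> 2 * n"
    and N: "real N \<ge> 4 * real n * (sqrt (real n * real L) + 1)"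
  shows "\<exists>r s. strict_mono_on {1..n} r \<and> strict_mono_on {1..n} s \<and>
    (\<forall>i\<in>{1..n}. r i < N \<and> s i \<in> {1..N} \<and> \<not> B (r i) (s (\<pi> i)))"
proof -
  define w where "w = N div (2 * n)"
  define P where "P D i x = (\<exists>y\<in>block w (\<pi> i + D). \<not> B x y)" for D i x
  have wN: "2 * n * w \<le> N" by (simp add: w_def)
  \<comment> \<open>Blocks must be nonempty, since the fibre bound below picks a column from
    one.\<close>
  have w1: "w \<ge> 1"
  proof -
    have "4 * real n * 1 \<le> 4 * real n * (sqrt (real n * real L) + 1)"
      by (intro mult_left_mono) auto
    then have "2 * n \<le> N" using N by linarith
    then show ?thesis using n by (simp add: w_def div_greater_zero_iff Suc_le_eq)
  qed
  have blk: "block w (j + D) \<subseteq> {1..N}" if "j \<in> {1..n}" "D \<le> n" for j D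
  proof (rule block_subset)
    have "j + D \<le> 2 * n" using that by simp
    then show "(j + D) * w \<le> N" using wN by (meson mult_le_mono1 order_trans)
  qed (use that in simp)
  show ?thesis
  proof (cases "\<exists>D\<le>n. n < greedy (P D) N")
    case True
    then obtain D where D: "D \<le> n" "n < greedy (P D) N" by blast
    obtain r where r: "strict_mono_on {1..n} r" "\<And>i. i \<in> {1..n} \<Longrightarrow> r i < N"
        "\<And>i. i \<in> {1..n} \<Longrightarrow> P D i (r i)"
      using greedy_success[OF D(2)] by blast
    obtain y where y: "\<And>i. i \<in> {1..n} \<Longrightarrow> y i \<in> block w (\<pi> i + D) \<and> \<not> B (r i) (y i)"
      using r(3) unfolding P_def by metis
    have surj: "\<pi> ` {1..n} = {1..n}"
      using endo_inj_surj pi by blast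
    \<comment> \<open>The chosen columns are reindexed by position: \<open>s j\<close> lies in block
      \<open>j + D\<close>, so \<open>s\<close> increases because the blocks do.\<close>
    define s where "s = y \<circ> inv_into {1..n} \<pi>"
    have s: "s j \<in> block w (j + D)" if "j \<in> {1..n}" for j
    proof -
      have "j \<in> \<pi> ` {1..n}" using that surj by simp
      then show ?thesis
        using y[of "inv_into {1..n} \<pi> j"] by (simp add: s_def f_inv_into_f inv_into_into del: atLeastAtMost_iff)
    qed
    show ?thesis
    proof (rule exI[of _ r], rule exI[of _ s], intro conjI ballI)
      show "strict_mono_on {1..n} r" by fact
      show "strict_mono_on {1..n} s"
      proof (rule strict_mono_onI)
        fix i j assume "i \<in> {1..n}" "j \<in> {1..n}" "i < j"
        then show "s i < s j" by (intro block_less[OF s s]) auto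
      qed
      fix i assume i: "i \<in> {1..n}"
      have "s (\<pi> i) = y i" using i pi(1) by (simp add: s_def)
      then show "\<not> B (r i) (s (\<pi> i))" using y[OF i] by simp
      show "r i < N" using r(2)[OF i] .
      show "s i \<in> {1..N}" using s[OF i] blk[OF i D(1)] by blast
    qed
  next
    case False
    define p where "p D = greedy (P D)" for D
    have p: "p D x \<in> {1..n}" if "D \<le> n" "x < N" for D x
    proof -
      have "greedy (P D) N \<le> n" using False that(1) not_less by blast
      then show ?thesis
        using greedy_pos[of "P D" x] greedy_mono[of x N "P D"] that(2) by (simp add: p_def)
    qed
    have monop: "mono (p D)" for D
      unfolding p_def by (rule monoI) (rule greedy_mono)
    define F where "F D = {x. x < N \<and> \<not> P D (p D x) x}" for D
    define S where "S D = (\<lambda>x. (x, \<pi> (p D x) + D)) ` F D" for D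
    define U where "U = {(x, b). x < N \<and> b \<in> {1..2 * n} \<and> (\<forall>y\<in>block w b. B x y)}"
    have pi_p: "\<pi> (p D x) \<in> {1..n}" if "D \<le> n" "x < N" for D x
      using p[OF that] pi(2) by blast
    have finU: "finite U"
      by (rule finite_subset[of _ "{..<N} \<times> {1..2 * n}"]) (auto simp: U_def)
    have SU: "S D \<subseteq> U" if "D \<in> {..n}" for D
    proof
      fix u assume "u \<in> S D"
      then obtain x where x: "x \<in> F D" "u = (x, \<pi> (p D x) + D)" by (auto simp: S_def)
      then show "u \<in> U" using pi_p[of D x] that by (simp add: U_def F_def P_def)
    qed
    have cardS: "real (card (S D)) \<ge> real N + 1 - real n" if "D \<in> {..n}" for D
    proof -
      have "card (S D) = card (F D)"
        unfolding S_def by (rule card_image) (auto intro: inj_onI)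
      moreover have "card (F D) + p D N = Suc N"
        unfolding F_def p_def by (rule card_greedy_failures)
      moreover have "p D N \<le> n" using False that by (auto simp: p_def not_less)
      ultimately show ?thesis by linarith
    qed
    have ov: "card (S D \<inter> S E) \<le> L * (2 * n)" if "D < E" "E \<le> n" for D E
    proof -
      \<comment> \<open>A pair in \<open>S D\<close> remembers its row, so a common pair means
        failure in the same row at the same block under both offsets.\<close>
      define X where "X = {x \<in> F D \<inter> F E. \<pi> (p D x) + D = \<pi> (p E x) + E}"
      have XN: "x < N" if "x \<in> X" for x using that by (simp add: X_def F_def)
      have "finite X" by (rule finite_subset[of _ "{..<N}"]) (auto simp: XN)
      have "S D \<inter> S E = (\<lambda>x. (x, \<pi> (p D x) + D)) ` X"
        by (auto simp: S_def X_def)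
      then have "card (S D \<inter> S E) = card X"
        by (simp add: card_image inj_on_def)
      also have "\<dots> \<le> L * (2 * n)"
      proof (rule shift_overlap[OF pi(1) shift monop[of D] monop[of E] _ _ \<open>D < E\<close> \<open>finite X\<close>])
        show "p D ` X \<subseteq> {1..n}" "p E ` X \<subseteq> {1..n}"
          using XN p that by auto
        \<comment> \<open>In all rows of this fibre the same block \<open>\<pi> c + D\<close> is
          blue, so any one of its columns is blue in all these rows and \<open>col\<close>
          applies.\<close>
        fix c assume c: "c \<in> p D ` X"
        then have "c \<in> {1..n}" using XN p[of D] that by auto
        then have pc: "\<pi> c \<in> {1..n}" using pi(2) by blast
        then have "card (block w (\<pi> c + D)) = w" by (simp add: card_block)
        then obtain y where y: "y \<in> block w (\<pi> c + D)"
          using w1 by (metis card.empty equals0I not_one_le_zero)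
        have "card {x \<in> X. p D x = c} \<le> card {x. x < N \<and> B x y}"
          using y by (intro card_mono) (auto simp: X_def F_def P_def)
        also have "\<dots> \<le> 2 * n"
          using y blk[OF pc, of D] that by (intro col) auto
        finally show "card {x \<in> X. p D x = c} \<le> 2 * n" .
      qed (auto simp: X_def)
      finally show ?thesis .
    qed
    have ov': "real (card (S D \<inter> S E)) \<le> 2 * real n * real L" if "D \<in> {..n}" "E \<in> {..n}" "D \<noteq> E" for D E
    proof -
      have "card (S D \<inter> S E) \<le> L * (2 * n)"
        using ov[of D E] ov[of E D] that by (cases "D < E") (auto simp: Int_commute)
      then have "real (card (S D \<inter> S E)) \<le> real (L * (2 * n))" by (simp only: of_nat_le_iff)
      then show ?thesis by (simp add: mult_ac)
    qed
    \<comment> \<open>Two distinct values of \<open>\<pi>\<close> already give a shift between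
      singletons.\<close>
    have L1: "real L \<ge> 1" if "n \<ge> 2"
    proof -
      have "\<pi> 1 \<noteq> \<pi> 2" using pi(1) that by (auto dest: inj_onD)
      moreover have "1 \<in> {1..n}" "2 \<in> {1..n}" using that by auto
      ultimately obtain c d where cd: "c \<in> {1..n}" "d \<in> {1..n}" "\<pi> d < \<pi> c"
        by (meson linorder_neqE_nat)
      have "card {c} \<le> L"
        by (rule shift[of _ "\<lambda>_. d" "\<pi> c - \<pi> d"]) (use cd in \<open>auto simp: strict_mono_on_def\<close>)
      then show ?thesis by simp
    qed
    have U: "card U * w \<le> 2 * n * N"
      unfolding U_def using row wN by (rule card_full_blocks)
    have T: "(\<Sum>D\<le>n. real (card (S D))) \<ge> real (n + 1) * (real N + 1 - real n)"
      using sum_mono[of "{..n}" "\<lambda>_. real N + 1 - real n", OF cardS] by simp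
    have "(\<Sum>D\<le>n. real (card (S D)))\<^sup>2 \<le>
        ((\<Sum>D\<le>n. real (card (S D))) + real (n + 1) * real n * (2 * real n * real L)) * real (card U)"
      using second_moment[of "{..n}" U S "2 * real n * real L", OF _ finU SU ov'] by simp
    from counting_contradiction[OF n L1 _ N w_def U T this] show ?thesis by simp
  qed
qed

subsection \<open>Monochromatic copies and shifts\<close>

lemma ex_increasing_enumeration:
  assumes "finite (S :: nat set)"
  obtains \<phi> :: "nat \<Rightarrow> nat" where "strict_mono_on {1..card S} \<phi>" "\<phi> ` {1..card S} = S"
proof
  let ?xs = "sorted_list_of_set S" and ?f = "\<lambda>i. sorted_list_of_set S ! (i - 1)"
  have s: "sorted_wrt (<) ?xs" by simp
  show "strict_mono_on {1..card S} ?f"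
    by (rule strict_mono_onI) (auto intro!: sorted_wrt_nth_less[OF s])
  have "{1..card S} = Suc ` {..<length ?xs}"
    by (simp add: image_Suc_lessThan)
  then have "?f ` {1..card S} = (!) ?xs ` {..<length ?xs}"
    by (simp only: image_image diff_Suc_1)
  also have "\<dots> = set ?xs"
    by (auto simp: set_conv_nth)
  finally show "?f ` {1..card S} = S"
    using assms by simp
qed

lemma mono_copy_complete:
  assumes "S \<subseteq> {1..K}" "\<And>x y. x \<in> S \<Longrightarrow> y \<in> S \<Longrightarrow> x \<noteq> y \<Longrightarrow> \<chi> {x, y} = c"
  shows "\<exists>\<phi>. mono_copy \<chi> c (complete_ograph K) (complete_ograph (card S)) \<phi>"
proof -
  have "finite S" using assms(1) finite_subset by blast
  then obtain \<phi> :: "nat \<Rightarrow> nat"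
    where \<phi>: "strict_mono_on {1..card S} \<phi>" "\<phi> ` {1..card S} = S"
    by (rule ex_increasing_enumeration)
  have "\<phi> ` e \<in> edges (complete_ograph K) \<and> \<chi> (\<phi> ` e) = c"
    if "e \<in> edges (complete_ograph (card S))" for e
  proof -
    have e: "e \<subseteq> {1..card S} \<and> card e = 2" using that by (simp add: complete_ograph_def)
    then obtain i j where ij: "e = {i, j}" "i \<noteq> j" by (meson card_2_iff)
    have i: "i \<in> {1..card S}" "j \<in> {1..card S}" using e ij by auto
    have ne: "\<phi> i \<noteq> \<phi> j"
      using strict_mono_on_imp_inj_on[OF \<phi>(1)] i ij(2) by (meson inj_onD)
    have S: "\<phi> i \<in> S" "\<phi> j \<in> S" using \<phi>(2) i by blast+
    then have "\<chi> {\<phi> i, \<phi> j} = c" "{\<phi> i, \<phi> j} \<subseteq> {1..K}"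
      using assms(1) assms(2)[OF S ne] by blast+
    then show ?thesis
      using ne by (simp add: complete_ograph_def ij(1))
  qed
  moreover have "\<phi> ` verts (complete_ograph (card S)) \<subseteq> verts (complete_ograph K)"
    using \<phi>(2) assms(1) by (simp add: complete_ograph_def)
  moreover have "strict_mono_on (verts (complete_ograph (card S))) \<phi>"
    using \<phi>(1) by (simp add: complete_ograph_def)
  ultimately show ?thesis unfolding mono_copy_def by blast
qed

text \<open>A blue edge between two blue neighbours of \<open>v\<close> would close a blue triangle,
  so \<open>m\<close> such neighbours would span a red clique.\<close>

lemma blue_degree_bound:
  assumes tri: "\<nexists>\<phi>. mono_copy \<chi> Blue (complete_ograph K) (complete_ograph 3) \<phi>"
    and clique: "\<nexists>\<phi>. mono_copy \<chi> Red (complete_ograph K) (complete_ograph m) \<phi>"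
    and v: "v \<in> {1..K}"
  shows "card {u \<in> {1..K}. u \<noteq> v \<and> \<chi> {u, v} = Blue} < m"
proof (rule ccontr)
  let ?W = "{u \<in> {1..K}. u \<noteq> v \<and> \<chi> {u, v} = Blue}"
  assume "\<not> card ?W < m"
  then obtain S where S: "S \<subseteq> ?W" "card S = m"
    by (meson not_less obtain_subset_with_card_n)
  have "\<chi> {x, y} = Red" if "x \<in> S" "y \<in> S" "x \<noteq> y" for x y
  proof (rule ccontr)
    assume "\<chi> {x, y} \<noteq> Red"
    then have "\<chi> {x, y} = Blue" using color.exhaust by blast
    moreover have "\<chi> {x, v} = Blue" "\<chi> {y, v} = Blue" "x \<noteq> v" "y \<noteq> v" "x \<in> {1..K}" "y \<in> {1..K}"
      using that S(1) by blast+
    ultimately have "\<exists>\<phi>. mono_copy \<chi> Blue (complete_ograph K) (complete_ograph (card {x, y, v})) \<phi>"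
      using v by (intro mono_copy_complete) (auto simp: insert_commute)
    moreover have "card {x, y, v} = 3"
      using \<open>x \<noteq> v\<close> \<open>y \<noteq> v\<close> \<open>x \<noteq> y\<close> by simp
    ultimately show False using tri by simp
  qed
  moreover have "S \<subseteq> {1..K}" using S(1) by blast
  ultimately show False
    using mono_copy_complete[of S K \<chi> Red] clique S(2) by blast
qed

lemma sorted_list_of_set_image_strict_mono:
  assumes "finite C" "strict_mono_on C f"
  shows "sorted_list_of_set (f ` C) = map f (sorted_list_of_set C)"
proof -
  have "sorted_wrt (\<lambda>x y. f x < f y) (sorted_list_of_set C)"
    by (rule sorted_wrt_mono_rel[OF _ strict_sorted_list_of_set])
      (use assms in \<open>auto simp: strict_mono_onD\<close>)
  then have "sorted_wrt (<) (map f (sorted_list_of_set C))"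
    by (simp add: sorted_wrt_map)
  then show ?thesis
    using assms(1) by (intro strict_sorted_equal) auto
qed

lemma card_le_max_shift:
  assumes C: "C \<subseteq> {1..n}" and f: "f ` C \<subseteq> {1..n}" "strict_mono_on C f"
    and "\<Delta> > 0" "\<And>c. c \<in> C \<Longrightarrow> \<pi> c = \<pi> (f c) + \<Delta>"
  shows "card C \<le> max_shift n \<pi>"
proof (cases "card C = 0")
  case False
  have fin: "finite C" using C finite_subset by blast
  have card: "card (f ` C) = card C"
    using strict_mono_on_imp_inj_on[OF f(2)] by (rule card_image)
  have "is_shift \<pi> C (f ` C)"
    unfolding is_shift_def sorted_list_of_set_image_strict_mono[OF fin f(2)]
  proof (intro conjI exI[of _ \<Delta>] allI impI)
    fix i assume i: "i < card C"
    then have "sorted_list_of_set C ! i \<in> C"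
      using nth_mem[of i "sorted_list_of_set C"] fin by simp
    then show "\<pi> (sorted_list_of_set C ! i) = \<pi> (map f (sorted_list_of_set C) ! i) + \<Delta>"
      using assms(5) i by simp
  qed (use card \<open>\<Delta> > 0\<close> in simp_all)
  then have "card C \<in> {k. k > 0 \<and> (\<exists>C D. C \<subseteq> {1..n} \<and> D \<subseteq> {1..n} \<and>
      card C = k \<and> card D = k \<and> is_shift \<pi> C D)}"
    using False C f(1) card by auto
  moreover have "bdd_above {k. k > 0 \<and> (\<exists>C D. C \<subseteq> {1..n} \<and> D \<subseteq> {1..n} \<and>
      card C = k \<and> card D = k \<and> is_shift \<pi> C D)}"
  proof (rule bdd_aboveI[of _ n], clarify)
    fix C assume "C \<subseteq> {1..n}"
    then show "card C \<le> n" using card_mono[of "{1..n}" C] by simp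
  qed
  ultimately show ?thesis
    unfolding max_shift_def by (rule cSup_upper)
qed simp

subsection \<open>Matchings of interval chromatic number 2\<close>

text \<open>The \<open>LEAST\<close> is attained because some admissible partition exists: no edge
  fits into a singleton.\<close>

lemma interval_chromatic_number_witness:
  fixes M :: "'a::linorder ograph"
  assumes "ordered_graph M"
  shows "\<exists>P. partition_on (verts M) P \<and> finite P \<and> card P = interval_chromatic_number M \<and>
    (\<forall>I\<in>P. vertex_interval M I \<and> (\<forall>e\<in>edges M. \<not> e \<subseteq> I))"
  unfolding interval_chromatic_number_def
proof (rule LeastI_ex, intro exI conjI)
  let ?P = "(\<lambda>x. {x}) ` verts M"
  show "partition_on (verts M) ?P" by (rule partition_on_singletons)
  show "finite ?P" using assms by (simp add: ordered_graph_def)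
  show "\<forall>I\<in>?P. vertex_interval M I \<and> (\<forall>e\<in>edges M. \<not> e \<subseteq> I)"
  proof clarify
    fix v assume "v \<in> verts M"
    moreover have "\<not> e \<subseteq> {v}" if "e \<in> edges M" for e
    proof
      assume "e \<subseteq> {v}"
      then have "card e \<le> 1" using card_mono[of "{v}" e] by simp
      then show False using that assms by (simp add: ordered_graph_def)
    qed
    ultimately show "vertex_interval M {v} \<and> (\<forall>e\<in>edges M. \<not> e \<subseteq> {v})"
      by (auto simp: vertex_interval_def)
  qed
qed simp

text \<open>Double counting of incidences: each vertex of \<open>I\<close> lies on one edge and each
  edge has one vertex in \<open>I\<close>.\<close>

lemma card_transversal:
  assumes M: "ordered_matching M" and "I \<subseteq> verts M"
    and "\<And>e. e \<in> edges M \<Longrightarrow> card (e \<inter> I) = 1"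
  shows "card I = card (edges M)"
proof -
  have fin: "finite (verts M)" "edges M \<subseteq> Pow (verts M)"
    using M by (auto simp: ordered_matching_def ordered_graph_def)
  then have finE: "finite (edges M)" by (meson finite_Pow_iff finite_subset)
  have "(\<Sum>e\<in>edges M. card {v \<in> I. v \<in> e}) = 1 * card I"
    using M assms(2) fin finE by (intro sum_multicount) (auto simp: ordered_matching_def intro: finite_subset)
  moreover have "{v \<in> I. v \<in> e} = e \<inter> I" for e by auto
  ultimately show ?thesis using assms(3) by simp
qed

text \<open>Every edge meets both classes of an optimal partition once, so by
  \<open>card_transversal\<close> the classes have equal size \<open>n\<close>. The class containing
  1 is an interval and hence equals \<open>{1..n}\<close>.\<close>

lemma bipartite_edges:
  fixes M :: "nat ograph"
  assumes M: "ordered_matching M" "verts M = {1..2 * n}" and chi: "interval_chromatic_number M = 2"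
    and n: "n > 0" and e: "e \<in> edges M"
  obtains i j where "i \<in> {1..n}" "j \<in> {n + 1..2 * n}" "e = {i, j}"
proof -
  have og: "ordered_graph M" using M by (simp add: ordered_matching_def)
  obtain P where P: "partition_on {1..2 * n} P" "card P = 2"
      "\<And>I. I \<in> P \<Longrightarrow> vertex_interval M I" "\<And>I e. I \<in> P \<Longrightarrow> e \<in> edges M \<Longrightarrow> \<not> e \<subseteq> I"
    using interval_chromatic_number_witness[OF og] chi M(2) by auto
  have "1 \<in> \<Union>P" using P(1) n by (auto simp: partition_on_def)
  then obtain I where I: "I \<in> P" "1 \<in> I" by blast
  then obtain J where PJ: "P = {I, J}" "I \<noteq> J"
    using P(2) by (auto simp: card_2_iff doubleton_eq_iff)
  have un: "I \<union> J = {1..2 * n}" and dj: "I \<inter> J = {}"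
    using P(1) PJ by (auto simp: partition_on_def disjoint_def)
  have eq: "card (f \<inter> I) = 1 \<and> card (f \<inter> J) = 1" if f: "f \<in> edges M" for f
  proof -
    obtain a b where ab: "f = {a, b}" "a \<noteq> b"
      using og f unfolding ordered_graph_def by (meson card_2_iff)
    have "f \<subseteq> I \<union> J" using og f M(2) un by (auto simp: ordered_graph_def)
    have "\<not> f \<subseteq> I" "\<not> f \<subseteq> J" using P(4)[OF _ f] PJ(1) by simp_all
    then consider "a \<in> I" "b \<in> J" "a \<notin> J" "b \<notin> I" | "b \<in> I" "a \<in> J" "b \<notin> J" "a \<notin> I"
      using ab(1) \<open>f \<subseteq> I \<union> J\<close> dj by blast
    then show ?thesis using ab by cases simp_all
  qed
  have sub: "I \<subseteq> verts M" "J \<subseteq> verts M" using un M(2) by auto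
  have "card I = card J"
    using card_transversal[OF M(1) sub(1)] card_transversal[OF M(1) sub(2)] eq by simp
  moreover have finIJ: "finite I" "finite J" using un by (metis finite_Un finite_atLeastAtMost)+
  moreover have "card I + card J = 2 * n"
    using card_Un_disjoint[OF finIJ dj] un by simp
  ultimately have cI: "card I = n" by simp
  define a where "a = Max I"
  have a: "a \<in> I" using I finIJ by (auto simp: a_def intro: Max_in)
  have "I = {1..a}"
  proof
    show "I \<subseteq> {1..a}" using finIJ un by (auto simp: a_def)
    show "{1..a} \<subseteq> I"
    proof
      fix y assume y: "y \<in> {1..a}"
      have "vertex_interval M I" using P(3) I by simp
      moreover have "y \<in> verts M"
      proof -
        have "a \<le> 2 * n" using a un by auto
        then show ?thesis using y M(2) by simp
      qed
      moreover have "1 \<le> y" "y \<le> a" using y by auto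
      ultimately show "y \<in> I" using I(2) a unfolding vertex_interval_def by blast
    qed
  qed
  with cI have In: "I = {1..n}" by simp
  have "J = {1..2 * n} - I" using un dj by blast
  then have Jn: "J = {n + 1..2 * n}" unfolding In by auto
  obtain i j where "e \<inter> I = {i}" "e \<inter> J = {j}"
    using eq[OF e] by (meson card_1_singletonE)
  moreover have "e = (e \<inter> I) \<union> (e \<inter> J)"
    using e og un M(2) by (auto simp: ordered_graph_def)
  ultimately have "i \<in> I" "j \<in> J" "e = {i, j}" by auto
  then show ?thesis
    using that In Jn by blast
qed

lemma matching_edge_unique:
  assumes "ordered_matching M" "v \<in> verts M"
  shows "\<exists>!e. e \<in> edges M \<and> v \<in> e"
proof -
  have "card {e \<in> edges M. v \<in> e} = 1" using assms by (simp add: ordered_matching_def)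
  then obtain e where e: "{f \<in> edges M. v \<in> f} = {e}" by (meson card_1_singletonE)
  have "f \<in> edges M \<and> v \<in> f \<longleftrightarrow> f = e" for f
    using e by (metis (mono_tags, lifting) mem_Collect_eq singleton_iff)
  then show ?thesis by metis
qed

text \<open>The partner of \<open>i\<close> is unique and lies above \<open>n\<close>, so the
  \<open>THE\<close> is well defined and subtracting \<open>n\<close> is not truncated.\<close>

lemma matching_perm_edge:
  assumes M: "ordered_matching M" "verts M = {1..2 * n}" and chi: "interval_chromatic_number M = 2"
    and n: "n > 0" and i: "i \<in> {1..n}"
  shows "matching_perm n M i \<in> {1..n}" "{i, n + matching_perm n M i} \<in> edges M"
proof -
  have iv: "i \<in> verts M" using i M(2) by simp
  obtain e where e: "e \<in> edges M" "i \<in> e" using matching_edge_unique[OF M(1) iv] by blast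
  obtain i' j where ij: "i' \<in> {1..n}" "j \<in> {n + 1..2 * n}" "e = {i', j}"
    using bipartite_edges[OF M chi n e(1)] .
  have ie: "e = {i, j}" using ij e(2) i by auto
  have "(THE k. i < k \<and> {i, k} \<in> edges M) = j"
  proof (rule the_equality)
    show "i < j \<and> {i, j} \<in> edges M" using ie e ij i by auto
    fix k assume "i < k \<and> {i, k} \<in> edges M"
    then have "{i, k} = {i, j}" using matching_edge_unique[OF M(1) iv] ie e(1) by blast
    then show "k = j" by (metis doubleton_eq_iff)
  qed
  then have "matching_perm n M i = j - n" using i by (simp add: matching_perm_def)
  then show "matching_perm n M i \<in> {1..n}" "{i, n + matching_perm n M i} \<in> edges M"
    using ij(2) ie e(1) by auto
qed

lemma inj_on_matching_perm:
  assumes "ordered_matching M" "verts M = {1..2 * n}" "interval_chromatic_number M = 2" "n > 0"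
  shows "inj_on (matching_perm n M) {1..n}"
proof (rule inj_onI)
  fix i k assume ik: "i \<in> {1..n}" "k \<in> {1..n}" "matching_perm n M i = matching_perm n M k"
  let ?j = "n + matching_perm n M i"
  have "?j \<in> verts M" using matching_perm_edge(1)[OF assms ik(1)] assms(2) by auto
  then have "{i, ?j} = {k, ?j}"
    using matching_edge_unique[OF assms(1)] matching_perm_edge(2)[OF assms ik(1)]
      matching_perm_edge(2)[OF assms ik(2)] ik(3) by (metis insertI1 insert_commute)
  then show "i = k" by (metis doubleton_eq_iff)
qed

lemma edge_matching_perm:
  assumes "ordered_matching M" "verts M = {1..2 * n}" "interval_chromatic_number M = 2" "n > 0"
    and "e \<in> edges M"
  obtains i where "i \<in> {1..n}" "e = {i, n + matching_perm n M i}"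
proof -
  obtain i j where ij: "i \<in> {1..n}" "e = {i, j}"
    using bipartite_edges[OF assms] .
  have "i \<in> verts M" using ij assms(2) by simp
  then have "e = {i, n + matching_perm n M i}"
    using matching_edge_unique[OF assms(1)] matching_perm_edge(2)[OF assms(1-4) ij(1)] assms(5) ij(2)
    by (metis insertI1)
  then show ?thesis using that ij(1) by blast
qed

subsection \<open>Triangles, cliques and matchings\<close>

theorem theorem5:
  fixes n N :: nat and l :: real and M :: "nat ograph" and \<chi> :: "nat set \<Rightarrow> color"
  assumes "n > 0" and "l > 0"
    and "ordered_matching M" and "verts M = {1..2 * n}"
    and "interval_chromatic_number M = 2"
    and "real (max_shift n (matching_perm n M)) \<le> l"
    and "real N \<ge> 4 * real n * (sqrt (real n * l) + 1)"
  shows "(\<exists>\<phi>. mono_copy \<chi> Blue (complete_ograph (2 * N)) (complete_ograph 3) \<phi>) \<or>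
    (\<exists>\<phi>. mono_copy \<chi> Red (complete_ograph (2 * N)) (complete_ograph (2 * n)) \<phi>) \<or>
    (\<exists>\<phi>. mono_copy \<chi> Red (complete_ograph (2 * N)) M \<phi> \<and>
         \<phi> ` {1..n} \<subseteq> {1..N} \<and> \<phi> ` {n + 1..2 * n} \<subseteq> {N + 1..2 * N})"
proof -
  let ?\<pi> = "matching_perm n M" and ?K = "complete_ograph (2 * N)"
  have "\<exists>\<phi>. mono_copy \<chi> Red ?K M \<phi> \<and> \<phi> ` {1..n} \<subseteq> {1..N} \<and> \<phi> ` {n + 1..2 * n} \<subseteq> {N + 1..2 * N}"
    if "\<nexists>\<phi>. mono_copy \<chi> Blue ?K (complete_ograph 3) \<phi>"
      "\<nexists>\<phi>. mono_copy \<chi> Red ?K (complete_ograph (2 * n)) \<phi>"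
  proof -
    note deg = blue_degree_bound[OF that]
    note M = assms(3,4,5,1)
    \<comment> \<open>Row \<open>x\<close> is the vertex \<open>x + 1\<close> of the left half,
      since the greedy scan starts at row 0; column \<open>y\<close> is the vertex
      \<open>N + y\<close> of the right half.\<close>
    define B where "B x y \<longleftrightarrow> \<chi> {Suc x, N + y} = Blue" for x y
    have row: "card {y \<in> {1..N}. B x y} \<le> 2 * n" if "x < N" for x
    proof -
      have "card {y \<in> {1..N}. B x y} = card ((+) N ` {y \<in> {1..N}. B x y})"
        by (simp add: card_image)
      also have "\<dots> \<le> card {u \<in> {1..2 * N}. u \<noteq> Suc x \<and> \<chi> {u, Suc x} = Blue}"
        using that by (intro card_mono) (auto simp: B_def insert_commute)
      also have "\<dots> \<le> 2 * n" using deg[of "Suc x"] that by simp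
      finally show ?thesis .
    qed
    have col: "card {x. x < N \<and> B x y} \<le> 2 * n" if "y \<in> {1..N}" for y
    proof -
      have "card {x. x < N \<and> B x y} = card (Suc ` {x. x < N \<and> B x y})"
        by (simp add: card_image)
      also have "\<dots> \<le> card {u \<in> {1..2 * N}. u \<noteq> N + y \<and> \<chi> {u, N + y} = Blue}"
        using that by (intro card_mono) (auto simp: B_def)
      also have "\<dots> \<le> 2 * n" using deg[of "N + y"] that by simp
      finally show ?thesis .
    qed
    have "4 * real n * (sqrt (real n * real (max_shift n ?\<pi>)) + 1) \<le> 4 * real n * (sqrt (real n * l) + 1)"
      using assms(6) by (intro mult_left_mono add_right_mono real_sqrt_le_mono) auto
    with assms(7) have N: "4 * real n * (sqrt (real n * real (max_shift n ?\<pi>)) + 1) \<le> real N"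
      by linarith
    have im: "?\<pi> ` {1..n} \<subseteq> {1..n}" using matching_perm_edge(1)[OF M] by blast
    have "\<exists>r s. strict_mono_on {1..n} r \<and> strict_mono_on {1..n} s \<and>
        (\<forall>i\<in>{1..n}. r i < N \<and> s i \<in> {1..N} \<and> \<not> B (r i) (s (?\<pi> i)))"
    proof (rule permutation_in_sparse_matrix)
      fix C f \<Delta>
      assume "C \<subseteq> {1..n}" "f ` C \<subseteq> {1..n}" "strict_mono_on C f" "(\<Delta>::nat) > 0"
        "\<And>c. c \<in> C \<Longrightarrow> ?\<pi> c = ?\<pi> (f c) + \<Delta>"
      then show "card C \<le> max_shift n ?\<pi>" by (rule card_le_max_shift)
    qed (fact assms(1) inj_on_matching_perm[OF M] im row col N)+
    then obtain r s where rs: "strict_mono_on {1..n} r" "strict_mono_on {1..n} s"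
        "\<And>i. i \<in> {1..n} \<Longrightarrow> r i < N \<and> s i \<in> {1..N} \<and> \<not> B (r i) (s (?\<pi> i))"
      by blast
    \<comment> \<open>An edge \<open>{i, n + \<pi> i}\<close>, where \<open>\<pi>\<close> is the
      permutation of \<open>M\<close>, is sent to row \<open>r i\<close> and column
      \<open>s (\<pi> i)\<close>, an entry that is not blue.\<close>
    define \<phi> where "\<phi> i = (if i \<le> n then Suc (r i) else N + s (i - n))" for i
    have left: "\<phi> i \<in> {1..N}" if "i \<in> {1..n}" for i
      using rs(3)[OF that] that by (simp add: \<phi>_def)
    have right: "\<phi> i \<in> {N + 1..2 * N}" if "i \<in> {n + 1..2 * n}" for i
    proof -
      have "i - n \<in> {1..n}" using that by auto
      then show ?thesis using rs(3)[of "i - n"] that by (simp add: \<phi>_def)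
    qed
    have "strict_mono_on {1..2 * n} \<phi>"
    proof (rule strict_mono_onI)
      fix i j assume ij: "i \<in> {1..2 * n}" "j \<in> {1..2 * n}" "i < j"
      consider "j \<le> n" | "i \<le> n" "n < j" | "n < i" by linarith
      then show "\<phi> i < \<phi> j"
      proof cases
        case 1
        then show ?thesis using ij strict_mono_onD[OF rs(1), of i j] by (simp add: \<phi>_def)
      next
        case 2
        then show ?thesis using ij left[of i] right[of j] by simp
      next
        case 3
        then show ?thesis using ij strict_mono_onD[OF rs(2), of "i - n" "j - n"] by (simp add: \<phi>_def)
      qed
    qed
    moreover have "\<phi> ` {1..2 * n} \<subseteq> {1..2 * N}"
    proof
      fix y assume "y \<in> \<phi> ` {1..2 * n}"
      then obtain i where "i \<in> {1..2 * n}" "y = \<phi> i" by blast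
      then show "y \<in> {1..2 * N}" using left[of i] right[of i] by (cases "i \<le> n") auto
    qed
    moreover have "\<phi> ` e \<subseteq> {1..2 * N} \<and> card (\<phi> ` e) = 2 \<and> \<chi> (\<phi> ` e) = Red" if e: "e \<in> edges M" for e
    proof -
      obtain i where i: "i \<in> {1..n}" "e = {i, n + ?\<pi> i}"
        using edge_matching_perm[OF M e] .
      have p: "?\<pi> i \<in> {1..n}" using im i(1) by blast
      have im: "\<phi> ` e = {Suc (r i), N + s (?\<pi> i)}"
        using i p by (auto simp: \<phi>_def)
      have "\<chi> (\<phi> ` e) \<noteq> Blue" using rs(3)[OF i(1)] by (simp add: im B_def)
      then have "\<chi> (\<phi> ` e) = Red" using color.exhaust by blast
      then show ?thesis using rs(3)[OF i(1)] rs(3)[OF p] by (auto simp: im)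
    qed
    ultimately have "mono_copy \<chi> Red ?K M \<phi>"
      by (simp add: mono_copy_def complete_ograph_def assms(4))
    then show ?thesis using left right by blast
  qed
  then show ?thesis by blast
qed

end
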